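(* Assume the following (the case $n=1$ of a conjecture): for all integers $m\ge 2$, $0\le i\le m-1$ and $0\le h\le m-i$ there exists $\kappa\ge1$ such that $(H_{ih,21}(m))^\kappa$ belongs to the ideal of $\mathbb C[a_0,\dots,a_m]$ generated by $D(m,0),\dots,D(m,i)$. Then for all integers $m,i,\vartheta$ with $m>i\ge 1$ and $\vartheta\ge 1$, $$\nu_{m,\vartheta}\bigl(X(m,i)\times\mathbb P^{\vartheta}\bigr)\subset X(m+\vartheta,i).$$
   Context: All polynomials and varieties are over $\mathbb C$; $a_\kappa=0$ for $\kappa\notin\{0,\dots,m\}$. $\mathfrak M(m)(a_0,\dots,a_m)$ is the $(m-1)\times(m-1)$ matrix whose $(\alpha,\beta)$ entry is $a_{2\beta-\alpha}$. $D(m,\iota)\in\mathbb Z[a_0,\dots,a_m]$ is the coefficient of $U^\iota$ in $\det(\mathfrak M(m)(a_0,\dots,a_m)-U\cdot I_{m-1})$. For $m>i\ge1$, $X(m,i)\subset\mathbb P^m(\mathbb C)$ is the set of common zeros of $D(m,0),\dots,D(m,i-1)$. The polynomials $H_{ih,21}(m)\in\mathbb Z[a_0,\dots,a_m]$ are defined as follows: let $\mathcal M$ be the $m\times m$ matrix whose $(\alpha,\beta)$ entry is $a_{2\beta-\alpha}t-a_{2\beta-\alpha-1}$; then $$\det(I_m-\mathcal M T)=\sum_{i=0}^{m}\sum_{h=0}^{m-i}H_{ih,21}(m)\,t^{h}\,T^{m-i}.$$ The map $\nu_{m,\vartheta}:\mathbb P^m\times\mathbb P^\vartheta\to\mathbb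 P^{m+\vartheta}$ is multiplication of polynomials: $\nu_{m,\vartheta}\bigl((\lambda_0:\dots:\lambda_m),(b_0:\dots:b_\vartheta)\bigr)=(a_0:\dots:a_{m+\vartheta})$ with $\sum_s a_sx^s=\bigl(\sum_s\lambda_sx^s\bigr)\bigl(\sum_s b_sx^s\bigr)$. *)

theory Defs
  imports
    Jordan_Normal_Form.Determinant
    "HOL-Algebra.Ideal"
    "HOL-Library.Poly_Mapping"
begin

text \<open>
  Polynomials over the complex numbers in the variables \<open>a\<^sub>0, a\<^sub>1, a\<^sub>2, \<dots>\<close> are finitely
  supported maps from monomials to coefficients, a monomial being a finitely supported map from
  variable indices to exponents. Multiplication on this type is the convolution product.
\<close>

type_synonym cpoly = "(nat \<Rightarrow>\<^sub>0 nat) \<Rightarrow>\<^sub>0 complex"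

definition var :: "nat \<Rightarrow> cpoly" where
  "var k = Poly_Mapping.single (Poly_Mapping.single k 1) 1"

definition eval :: "(nat \<Rightarrow> complex) \<Rightarrow> cpoly \<Rightarrow> complex" where
  "eval a p =
     (\<Sum>u\<in>Poly_Mapping.keys p. Poly_Mapping.lookup p u *
        (\<Prod>k\<in>Poly_Mapping.keys u. a k ^ Poly_Mapping.lookup u k))"

text \<open>The ring \<open>\<complex>[a\<^sub>0, \<dots>, a\<^sub>m]\<close>, as a subring of the type above.\<close>

definition poly_ring :: "nat \<Rightarrow> cpoly ring" where
  "poly_ring m =
     \<lparr>carrier = {p. \<forall>u\<in>Poly_Mapping.keys p. Poly_Mapping.keys u \<subseteq> {..m}},
      mult = (*), one = 1, zero = 0, add = (+)\<rparr>"

definition indet :: "nat \<Rightarrow> int \<Rightarrow> cpoly" where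
  "indet m \<kappa> = (if 0 \<le> \<kappa> \<and> \<kappa> \<le> int m then var (nat \<kappa>) else 0)"

text \<open>
  Matrix indices in the library start from 0, so position \<open>(r, c)\<close> is the entry with
  \<open>\<alpha> = r + 1\<close> and \<open>\<beta> = c + 1\<close>.
\<close>

definition matM :: "nat \<Rightarrow> cpoly mat" where
  "matM m = mat (m - 1) (m - 1)
     (\<lambda>(r, c). let \<alpha> = int r + 1; \<beta> = int c + 1 in indet m (2 * \<beta> - \<alpha>))"

definition D :: "nat \<Rightarrow> nat \<Rightarrow> cpoly" where
  "D m \<iota> = coeff (det (map_mat (\<lambda>p. [:p:]) (matM m) - [:0, 1:] \<cdot>\<^sub>m 1\<^sub>m (m - 1))) \<iota>"

text \<open>In the type \<^typ>\<open>cpoly poly poly\<close> the inner indeterminate is \<open>t\<close> and the outer one is \<open>T\<close>.\<close>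

definition matMt :: "nat \<Rightarrow> cpoly poly mat" where
  "matMt m = mat m m
     (\<lambda>(r, c). let \<alpha> = int r + 1; \<beta> = int c + 1
       in [:0, indet m (2 * \<beta> - \<alpha>):] - [:indet m (2 * \<beta> - \<alpha> - 1):])"

definition H21 :: "nat \<Rightarrow> nat \<Rightarrow> nat \<Rightarrow> cpoly" where
  "H21 m i h =
     coeff (coeff (det (1\<^sub>m m - [:0, 1:] \<cdot>\<^sub>m map_mat (\<lambda>p. [:p:]) (matMt m))) (m - i)) h"

text \<open>
  Points of projective \<open>m\<close>-space are classes, up to nonzero scalars, of nonzero coordinate
  vectors; such a vector is a function on \<open>\<nat>\<close> that vanishes beyond \<open>m\<close>.
\<close>

definition hcoords :: "nat \<Rightarrow> (nat \<Rightarrow> complex) set" where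
  "hcoords m = {a. (\<forall>k>m. a k = 0) \<and> (\<exists>k\<le>m. a k \<noteq> 0)}"

definition proj_rel :: "nat \<Rightarrow> ((nat \<Rightarrow> complex) \<times> (nat \<Rightarrow> complex)) set" where
  "proj_rel m =
     {(a, b). a \<in> hcoords m \<and> b \<in> hcoords m \<and> (\<exists>c. c \<noteq> 0 \<and> (\<forall>k. b k = c * a k))}"

definition proj_space :: "nat \<Rightarrow> (nat \<Rightarrow> complex) set set" where
  "proj_space m = hcoords m // proj_rel m"

definition X :: "nat \<Rightarrow> nat \<Rightarrow> (nat \<Rightarrow> complex) set set" where
  "X m i = {P \<in> proj_space m. \<forall>a\<in>P. \<forall>\<iota><i. eval a (D m \<iota>) = 0}"

definition coord_poly :: "nat \<Rightarrow> (nat \<Rightarrow> complex) \<Rightarrow> complex poly" where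
  "coord_poly m a = (\<Sum>s\<le>m. monom (a s) s)"

text \<open>The union is over representatives; by \<open>\<nu>_class\<close> below all of them give the same class.\<close>

definition \<nu> ::
  "nat \<Rightarrow> nat \<Rightarrow> (nat \<Rightarrow> complex) set \<times> (nat \<Rightarrow> complex) set \<Rightarrow> (nat \<Rightarrow> complex) set" where
  "\<nu> m \<theta> = (\<lambda>(P, Q). \<Union>l\<in>P. \<Union>b\<in>Q.
     proj_rel (m + \<theta>) `` {coeff (coord_poly m l * coord_poly \<theta> b)})"

lemma carrier_poly_ring_iff:
  "p \<in> carrier (poly_ring m) \<longleftrightarrow>
     (\<forall>u\<in>Poly_Mapping.keys p. Poly_Mapping.keys u \<subseteq> {..m})"
  by (simp add: poly_ring_def)

lemma poly_ring_closed:
  shows poly_ring_0: "0 \<in> carrier (poly_ring m)"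
    and poly_ring_1: "1 \<in> carrier (poly_ring m)"
    and poly_ring_var: "k \<le> m \<Longrightarrow> var k \<in> carrier (poly_ring m)"
    and poly_ring_uminus: "p \<in> carrier (poly_ring m) \<Longrightarrow> - p \<in> carrier (poly_ring m)"
    and poly_ring_add: "p \<in> carrier (poly_ring m) \<Longrightarrow> q \<in> carrier (poly_ring m)
          \<Longrightarrow> p + q \<in> carrier (poly_ring m)"
    and poly_ring_mult: "p \<in> carrier (poly_ring m) \<Longrightarrow> q \<in> carrier (poly_ring m)
          \<Longrightarrow> p * q \<in> carrier (poly_ring m)"
proof -
  show "0 \<in> carrier (poly_ring m)" "1 \<in> carrier (poly_ring m)"
    by (simp_all add: carrier_poly_ring_iff)
  show "k \<le> m \<Longrightarrow> var k \<in> carrier (poly_ring m)"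
    by (simp add: carrier_poly_ring_iff var_def)
  show "p \<in> carrier (poly_ring m) \<Longrightarrow> - p \<in> carrier (poly_ring m)"
    by (simp add: carrier_poly_ring_iff in_keys_iff)
  show "p \<in> carrier (poly_ring m) \<Longrightarrow> q \<in> carrier (poly_ring m)
      \<Longrightarrow> p + q \<in> carrier (poly_ring m)"
    unfolding carrier_poly_ring_iff using Poly_Mapping.keys_add[of p q] by blast
  assume p: "p \<in> carrier (poly_ring m)" and q: "q \<in> carrier (poly_ring m)"
  show "p * q \<in> carrier (poly_ring m)"
    unfolding carrier_poly_ring_iff
  proof
    fix u assume "u \<in> Poly_Mapping.keys (p * q)"
    then obtain v w where "v \<in> Poly_Mapping.keys p" "w \<in> Poly_Mapping.keys q" "u = v + w"
      using Poly_Mapping.keys_mult[of p q] by blast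
    with p q show "Poly_Mapping.keys u \<subseteq> {..m}"
      unfolding carrier_poly_ring_iff using Poly_Mapping.keys_add[of v w] by blast
  qed
qed

lemma poly_ring_simps:
  "mult (poly_ring m) = (*)" "one (poly_ring m) = 1"
  "zero (poly_ring m) = 0" "add (poly_ring m) = (+)"
  by (simp_all add: poly_ring_def)

lemma cring_poly_ring: "cring (poly_ring m)"
proof (rule cringI)
  show "abelian_group (poly_ring m)"
  proof (rule abelian_groupI)
    show "\<exists>y\<in>carrier (poly_ring m). y \<oplus>\<^bsub>poly_ring m\<^esub> x = \<zero>\<^bsub>poly_ring m\<^esub>"
      if "x \<in> carrier (poly_ring m)" for x
      using poly_ring_uminus[OF that] by (intro bexI[of _ "- x"]) (simp_all add: poly_ring_simps)
  qed (simp_all add: poly_ring_simps poly_ring_closed algebra_simps)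
  show "comm_monoid (poly_ring m)"
    by (rule comm_monoidI) (simp_all add: poly_ring_simps poly_ring_closed algebra_simps)
qed (simp add: poly_ring_simps algebra_simps)

lemma D_in_poly_ring: "D m \<iota> \<in> carrier (poly_ring m)"
proof -
  define S where "S = {p :: cpoly poly. \<forall>k. coeff p k \<in> carrier (poly_ring m)}"
  have sum_cl: "(\<Sum>x\<in>A. f x) \<in> carrier (poly_ring m)"
    if "\<And>x. x \<in> A \<Longrightarrow> f x \<in> carrier (poly_ring m)" for A :: "'x set" and f
    using that by (induction A rule: infinite_finite_induct)
      (auto intro: poly_ring_0 poly_ring_add)
  have S_1: "1 \<in> S"
    by (auto simp: S_def coeff_1 poly_ring_0 poly_ring_1)
  have S_mult: "p * q \<in> S" if "p \<in> S" "q \<in> S" for p q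
    using that by (auto simp: S_def coeff_mult intro!: sum_cl poly_ring_mult)
  have S_sum: "(\<Sum>x\<in>A. f x) \<in> S" if "\<And>x. x \<in> A \<Longrightarrow> f x \<in> S" for A :: "'x set" and f
    using that by (auto simp: S_def coeff_sum intro!: sum_cl)
  have S_prod: "(\<Prod>x\<in>A. f x) \<in> S" if "\<And>x. x \<in> A \<Longrightarrow> f x \<in> S" for A :: "'x set" and f
    using that by (induction A rule: infinite_finite_induct) (auto intro: S_1 S_mult)
  have S_uminus: "- p \<in> S" if "p \<in> S" for p
    using that by (auto simp: S_def intro: poly_ring_uminus)
  have S_diff: "p - q \<in> S" if "p \<in> S" "q \<in> S" for p q
    using that poly_ring_add[OF _ poly_ring_uminus] by (auto simp: S_def)
  have S_sign: "signof p \<in> S" for p :: "nat \<Rightarrow> nat"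
    using S_uminus[OF S_1] S_1 by (auto simp: sign_def)
  have S_pCons: "pCons c p \<in> S" if "c \<in> carrier (poly_ring m)" "p \<in> S" for c p
    using that by (auto simp: S_def coeff_pCons split: nat.split)
  have S_0: "0 \<in> S"
    by (auto simp: S_def poly_ring_0)
  have indet: "indet m \<kappa> \<in> carrier (poly_ring m)" for \<kappa>
    by (auto simp: indet_def poly_ring_0 intro: poly_ring_var)
  define A where "A = map_mat (\<lambda>p. [:p:]) (matM m) - [:0, 1:] \<cdot>\<^sub>m 1\<^sub>m (m - 1)"
  have dim: "dim_row A = m - 1" "dim_col A = m - 1"
    by (auto simp: A_def)
  have entry: "A $$ (i, j) \<in> S" if "i < m - 1" "j < m - 1" for i j
  proof -
    have "A $$ (i, j) = [:indet m (2 * (int j + 1) - (int i + 1)):]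
        - [:0, 1:] * (if i = j then 1 else 0)"
      using that by (simp add: A_def matM_def Let_def)
    also have "\<dots> \<in> S"
      by (intro S_diff S_mult S_pCons S_0 indet poly_ring_0 poly_ring_1) (simp add: S_0 S_1)
    finally show ?thesis .
  qed
  have "A $$ (i, p i) \<in> S" if "p permutes {0..<m - 1}" "i \<in> {0..<m - 1}" for p i
    using entry[of i "p i"] permutes_in_image[OF that(1), of i] that(2) by simp
  then have "det A \<in> S"
    unfolding det_def dim if_P[OF refl] by (intro S_sum S_mult S_sign S_prod) blast
  then show ?thesis
    unfolding D_def A_def[symmetric] by (simp add: S_def)
qed

lemma equiv_proj_rel: "equiv (hcoords m) (proj_rel m)"
proof (rule equivI)
  show "proj_rel m \<subseteq> hcoords m \<times> hcoords m"
    by (auto simp: proj_rel_def)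
  show "refl_on (hcoords m) (proj_rel m)"
    by (auto simp: refl_on_def proj_rel_def intro: exI[of _ 1])
  show "sym (proj_rel m)"
  proof (rule symI)
    fix a b assume "(a, b) \<in> proj_rel m"
    then obtain c where "a \<in> hcoords m" "b \<in> hcoords m" "c \<noteq> 0" "\<forall>k. b k = c * a k"
      by (auto simp: proj_rel_def)
    then show "(b, a) \<in> proj_rel m"
      by (auto simp: proj_rel_def intro!: exI[of _ "inverse c"])
  qed
  show "trans (proj_rel m)"
  proof (rule transI)
    fix a b d assume "(a, b) \<in> proj_rel m" "(b, d) \<in> proj_rel m"
    then obtain c c' where "a \<in> hcoords m" "d \<in> hcoords m" "c \<noteq> 0" "c' \<noteq> 0"
      "\<forall>k. b k = c * a k" "\<forall>k. d k = c' * b k"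
      by (auto simp: proj_rel_def)
    then show "(a, d) \<in> proj_rel m"
      by (auto simp: proj_rel_def intro!: exI[of _ "c' * c"])
  qed
qed

lemma coeff_coord_poly: "coeff (coord_poly m a) k = (if k \<le> m then a k else 0)"
  by (simp add: coord_poly_def coeff_sum)

lemma mult_in_hcoords:
  assumes "l \<in> hcoords m" and "b \<in> hcoords \<theta>"
  shows "coeff (coord_poly m l * coord_poly \<theta> b) \<in> hcoords (m + \<theta>)"
proof -
  let ?p = "coord_poly m l" and ?q = "coord_poly \<theta> b"
  have deg: "degree ?p \<le> m" "degree ?q \<le> \<theta>"
    by (auto intro!: degree_le simp: coeff_coord_poly)
  have nz: "?p \<noteq> 0" "?q \<noteq> 0"
    using assms by (auto simp: hcoords_def poly_eq_iff coeff_coord_poly)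
  then have d: "degree (?p * ?q) \<le> m + \<theta>"
    using deg by (simp add: degree_mult_eq)
  moreover have "coeff (?p * ?q) (degree (?p * ?q)) \<noteq> 0"
    using nz leading_coeff_neq_0[of "?p * ?q"] by (metis mult_eq_0_iff)
  ultimately show ?thesis
    by (auto simp: hcoords_def intro: coeff_eq_0)
qed

lemma \<nu>_congruent:
  "congruent2 (proj_rel m) (proj_rel \<theta>)
     (\<lambda>l b. proj_rel (m + \<theta>) `` {coeff (coord_poly m l * coord_poly \<theta> b)})"
proof (rule congruent2I')
  fix l l' b b' assume rel: "(l, l') \<in> proj_rel m" "(b, b') \<in> proj_rel \<theta>"
  then obtain c d where cd: "c \<noteq> 0" "d \<noteq> 0" "\<forall>k. l' k = c * l k" "\<forall>k. b' k = d * b k"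
    by (auto simp: proj_rel_def)
  have "coord_poly m l' = smult c (coord_poly m l)"
    "coord_poly \<theta> b' = smult d (coord_poly \<theta> b)"
    using cd by (auto simp: poly_eq_iff coeff_coord_poly)
  then have "coeff (coord_poly m l' * coord_poly \<theta> b') k
      = (c * d) * coeff (coord_poly m l * coord_poly \<theta> b) k" for k
    by (simp add: mult_ac)
  moreover have "l \<in> hcoords m" "l' \<in> hcoords m" "b \<in> hcoords \<theta>" "b' \<in> hcoords \<theta>"
    using rel by (auto simp: proj_rel_def)
  ultimately have "(coeff (coord_poly m l * coord_poly \<theta> b),
      coeff (coord_poly m l' * coord_poly \<theta> b')) \<in> proj_rel (m + \<theta>)"
    using cd mult_in_hcoords by (auto simp: proj_rel_def intro!: exI[of _ "c * d"])
  then show "proj_rel (m + \<theta>) `` {coeff (coord_poly m l * coord_poly \<theta> b)}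
      = proj_rel (m + \<theta>) `` {coeff (coord_poly m l' * coord_poly \<theta> b')}"
    by (rule equiv_class_eq[OF equiv_proj_rel])
qed

lemma \<nu>_class:
  assumes "l \<in> hcoords m" and "b \<in> hcoords \<theta>"
  shows "\<nu> m \<theta> (proj_rel m `` {l}, proj_rel \<theta> `` {b})
    = proj_rel (m + \<theta>) `` {coeff (coord_poly m l * coord_poly \<theta> b)}"
  unfolding \<nu>_def prod.case
  by (rule UN_equiv_class2[OF equiv_proj_rel equiv_proj_rel \<nu>_congruent assms])

lemma \<nu>_maps_to: "\<nu> m \<theta> ` (proj_space m \<times> proj_space \<theta>) \<subseteq> proj_space (m + \<theta>)"
proof -
  have "\<nu> m \<theta> (P, Q) \<in> proj_space (m + \<theta>)" if "P \<in> proj_space m" "Q \<in> proj_space \<theta>" for P Q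
    using that unfolding proj_space_def
    by (auto elim!: quotientE simp: \<nu>_class intro!: quotientI mult_in_hcoords)
  then show ?thesis by auto
qed

end

(* Put the coefficients of a polynomial f of degree at most m into the matrix M(m). Up to sign, the
   D(m, j) become the coefficients of its characteristic polynomial, so X(m, i) consists of the f
   for which the i lowest of them vanish. The matrix defining the H_{jh,21}(m) becomes M(m + 1) of
   f * (t - x), and det (1 - N T) is the reciprocal of the characteristic polynomial of N; hence the
   sum over h of H_{jh,21}(m)(f) t^h is, up to sign, D(m + 1, j)(f * (t - x)). On X(m, i) the
   conjecture makes all these sums with j < i vanish identically in t, so multiplication by t - x
   maps X(m, i) to X(m + 1, i). Multiplication by 1, read as a linear factor with root at infinity,
   only multiplies the characteristic polynomial by a linear factor. Every polynomial of degree at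
   most theta is a product of theta such factors and a constant. *)

theory Submission
  imports Defs Jordan_Normal_Form.Char_Poly
begin

subsection \<open>Evaluation as a ring homomorphism\<close>

definition eval_monom :: "(nat \<Rightarrow> complex) \<Rightarrow> (nat \<Rightarrow>\<^sub>0 nat) \<Rightarrow> complex" where
  "eval_monom a u = (\<Prod>k\<in>Poly_Mapping.keys u. a k ^ Poly_Mapping.lookup u k)"

text \<open>Padding the index set with trivial factors lets \<open>u\<close>, \<open>v\<close> and
  \<open>u + v\<close> be compared factor by factor over one common set;
  \<open>eval_superset\<close> does the same for sums.\<close>

lemma eval_monom_superset:
  assumes "finite K" "Poly_Mapping.keys u \<subseteq> K"
  shows "eval_monom a u = (\<Prod>k\<in>K. a k ^ Poly_Mapping.lookup u k)"
  unfolding eval_monom_def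
  by (rule prod.mono_neutral_left) (use assms in \<open>auto simp: in_keys_iff\<close>)

lemma eval_monom_add: "eval_monom a (u + v) = eval_monom a u * eval_monom a v"
proof -
  define K where "K = Poly_Mapping.keys u \<union> Poly_Mapping.keys v"
  have K: "finite K" "Poly_Mapping.keys u \<subseteq> K" "Poly_Mapping.keys v \<subseteq> K"
    "Poly_Mapping.keys (u + v) \<subseteq> K"
    using Poly_Mapping.keys_add[of u v] by (auto simp: K_def)
  show ?thesis
    by (simp add: eval_monom_superset[OF K(1,2)] eval_monom_superset[OF K(1,3)]
        eval_monom_superset[OF K(1,4)] lookup_add power_add prod.distrib)
qed

lemma eval_superset:
  assumes "finite K" "Poly_Mapping.keys p \<subseteq> K"
  shows "eval a p = (\<Sum>u\<in>K. Poly_Mapping.lookup p u * eval_monom a u)"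
  unfolding eval_def eval_monom_def
  by (rule sum.mono_neutral_left) (use assms in \<open>auto simp: in_keys_iff\<close>)

lemma eval_single: "eval a (Poly_Mapping.single u c) = c * eval_monom a u"
  by (simp add: eval_def eval_monom_def)

lemma eval_0 [simp]: "eval a 0 = 0"
  by (simp add: eval_def)

lemma eval_add: "eval a (p + q) = eval a p + eval a q"
proof -
  define K where "K = Poly_Mapping.keys p \<union> Poly_Mapping.keys q"
  have K: "finite K" "Poly_Mapping.keys p \<subseteq> K" "Poly_Mapping.keys q \<subseteq> K"
    "Poly_Mapping.keys (p + q) \<subseteq> K"
    using Poly_Mapping.keys_add[of p q] by (auto simp: K_def)
  show ?thesis
    by (simp add: eval_superset[OF K(1,2)] eval_superset[OF K(1,3)]
        eval_superset[OF K(1,4)] lookup_add sum.distrib algebra_simps)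
qed

lemma update_eq_add_single:
  assumes "u \<notin> Poly_Mapping.keys p"
  shows "Poly_Mapping.update u c p = Poly_Mapping.single u c + p"
  using assms
  by (intro poly_mapping_eqI) (auto simp: lookup_update lookup_add lookup_single when_def in_keys_iff)

lemma eval_mult: "eval a (p * q) = eval a p * eval a q"
proof (induction p rule: update_induct)
  case const
  show ?case by simp
next
  case (update p u c)
  \<comment> \<open>By linearity in both factors it suffices to multiply two single terms, where the
    claim is \<open>eval_monom_add\<close>.\<close>
  have single: "eval a (Poly_Mapping.single u c * q) = eval a (Poly_Mapping.single u c) * eval a q"
  proof (induction q rule: update_induct)
    case (update q v d)
    then show ?case
      by (simp add: update_eq_add_single eval_add eval_single mult_single eval_monom_add
          algebra_simps)
  qed simp
  show ?case
    using update single by (simp add: update_eq_add_single eval_add algebra_simps)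
qed

interpretation eval: comm_ring_hom "eval a"
proof
  show "eval a 1 = 1"
    by (metis eval_single eval_monom_def keys_zero mult_1 prod.empty single_one)
qed (simp_all add: eval_add eval_mult)

lemma eval_var: "eval a (var k) = a k"
  by (simp add: var_def eval_single eval_monom_def)

lemma eval_indet: "eval a (indet m \<kappa>) = (if 0 \<le> \<kappa> \<and> \<kappa> \<le> int m then a (nat \<kappa>) else 0)"
  by (simp add: indet_def eval_var)

text \<open>The elements of the ring that vanish at \<open>a\<close> form an ideal containing
  \<open>S\<close>, hence containing the ideal generated by \<open>S\<close>; a complex number with
  a vanishing power is zero.\<close>

lemma eval_eq_0_if_power_in_ideal:
  assumes S: "S \<subseteq> carrier (poly_ring m)" and zero: "\<And>s. s \<in> S \<Longrightarrow> eval a s = 0"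
    and p: "p ^ \<kappa> \<in> Idl\<^bsub>poly_ring m\<^esub> S"
  shows "eval a p = 0"
proof -
  interpret cring "poly_ring m" by (rule cring_poly_ring)
  define I where "I = {q \<in> carrier (poly_ring m). eval a q = 0}"
  have "ideal I (poly_ring m)"
  proof (rule idealI)
    show "subgroup I (add_monoid (poly_ring m))"
    proof (rule add.subgroupI)
      show "I \<noteq> {}" by (auto simp: I_def poly_ring_0 intro!: exI[of _ 0])
      fix q assume "q \<in> I"
      moreover from this have "\<ominus>\<^bsub>poly_ring m\<^esub> q = - q"
        by (intro minus_equality) (auto simp: I_def poly_ring_simps poly_ring_uminus)
      ultimately show "\<ominus>\<^bsub>poly_ring m\<^esub> q \<in> I"
        by (auto simp: I_def poly_ring_uminus eval.hom_uminus)
    qed (auto simp: I_def poly_ring_simps poly_ring_add eval_add)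
  qed (auto simp: I_def poly_ring_simps poly_ring_mult eval_mult ring_axioms)
  moreover have "S \<subseteq> I" using S zero by (auto simp: I_def)
  ultimately have "p ^ \<kappa> \<in> I" using p genideal_minimal by blast
  then show ?thesis by (simp add: I_def eval.hom_power)
qed

subsection \<open>Characteristic polynomials\<close>

lemma poly_char_poly:
  assumes "A \<in> carrier_mat n n"
  shows "poly (char_poly A) x = det (x \<cdot>\<^sub>m 1\<^sub>m n - A)"
  unfolding char_poly_defs comm_ring_hom.hom_det[OF poly_hom.comm_ring_hom_axioms, symmetric]
  by (rule arg_cong[of _ _ det], rule eq_matI) (use assms in auto)

text \<open>Negating all \<open>n\<close> rows turns the convention of \<open>D\<close> into that of
  \<open>char_poly\<close>.\<close>

lemma det_minus_indeterminate:
  fixes A :: "'a :: comm_ring_1 mat"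
  assumes "A \<in> carrier_mat n n"
  shows "det (map_mat (\<lambda>p. [:p:]) A - [:0, 1:] \<cdot>\<^sub>m 1\<^sub>m n) = smult ((-1) ^ n) (char_poly A)"
proof -
  have "map_mat (\<lambda>p. [:p:]) A - [:0, 1:] \<cdot>\<^sub>m 1\<^sub>m n = [:-1:] \<cdot>\<^sub>m char_poly_matrix A"
    by (rule eq_matI) (use assms in \<open>auto simp: char_poly_matrix_def\<close>)
  then have "det (map_mat (\<lambda>p. [:p:]) A - [:0, 1:] \<cdot>\<^sub>m 1\<^sub>m n)
      = [:-1:] ^ n * char_poly A"
    using assms by (simp add: char_poly_defs)
  also have "[:-1:] ^ n = [:(-1) ^ n :: 'a:]"
    by (simp add: poly_const_pow)
  finally show ?thesis by simp
qed

text \<open>For nonzero x, det (1 - x A) is x^n times the characteristic polynomial at 1/x; its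
  degree is exactly \<open>n\<close>, so this is reflection.\<close>

lemma det_one_minus_indeterminate_mult:
  fixes A :: "'a :: field_char_0 mat"
  assumes A: "A \<in> carrier_mat n n"
  shows "det (1\<^sub>m n - [:0, 1:] \<cdot>\<^sub>m map_mat (\<lambda>p. [:p:]) A) = reflect_poly (char_poly A)"
    (is "?L = ?R")
proof -
  have deg: "degree (char_poly A) = n"
    using degree_monic_char_poly[OF A] by simp
  have "poly ([:0, 1:] * ?L) x = poly ([:0, 1:] * ?R) x" for x
  proof (cases "x = 0")
    case False
    have "map_mat (\<lambda>p. poly p x) (1\<^sub>m n - [:0, 1:] \<cdot>\<^sub>m map_mat (\<lambda>p. [:p:]) A)
        = x \<cdot>\<^sub>m (inverse x \<cdot>\<^sub>m 1\<^sub>m n - A)"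
      by (rule eq_matI) (use A False in \<open>auto simp: algebra_simps\<close>)
    then have "poly ?L x = x ^ n * poly (char_poly A) (inverse x)"
      using A by (simp add: poly_char_poly[OF A]
          comm_ring_hom.hom_det[OF poly_hom.comm_ring_hom_axioms, symmetric])
    then show ?thesis
      using False by (simp add: poly_reflect_poly_nz deg)
  qed simp
  then have "[:0, 1:] * ?L = [:0, 1:] * ?R"
    by (simp only: poly_eq_poly_eq_iff[symmetric] fun_eq_iff) blast
  then show ?thesis
    by (metis mult_cancel_left pCons_eq_0_iff zero_neq_one)
qed

text \<open>Pulling \<open>c\<close> out of det (x - c A) leaves c^n times the characteristic
  polynomial of \<open>A\<close> at x/c. Hence the vanishing of a coefficient does not depend on the
  choice of homogeneous coordinates.\<close>

lemma coeff_char_poly_smult: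
  fixes A :: "'a :: field_char_0 mat"
  assumes A: "A \<in> carrier_mat n n" and "c \<noteq> 0"
  shows "coeff (char_poly (c \<cdot>\<^sub>m A)) k = c ^ n * inverse c ^ k * coeff (char_poly A) k"
proof -
  have "poly (char_poly (c \<cdot>\<^sub>m A)) x
      = poly (smult (c ^ n) (char_poly A \<circ>\<^sub>p [:0, inverse c:])) x" for x
  proof -
    have "x \<cdot>\<^sub>m 1\<^sub>m n - c \<cdot>\<^sub>m A = c \<cdot>\<^sub>m ((inverse c * x) \<cdot>\<^sub>m 1\<^sub>m n - A)"
      by (rule eq_matI) (use assms in \<open>auto simp: algebra_simps\<close>)
    then show ?thesis
      using A by (simp add: poly_char_poly[of _ n] poly_pcompose mult.commute)
  qed
  then have "char_poly (c \<cdot>\<^sub>m A) = smult (c ^ n) (char_poly A \<circ>\<^sub>p [:0, inverse c:])"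
    by (simp add: poly_eq_poly_eq_iff[symmetric] fun_eq_iff)
  then show ?thesis
    by (simp add: coeff_pcompose_linear)
qed

text \<open>The bivariate polynomials whose T^k coefficient has t-degree at most \<open>k\<close>
  are closed under sums and products, so the Leibniz formula stays among them.\<close>

lemma degree_coeff_det_le:
  fixes A :: "'a :: comm_ring_1 poly poly mat"
  assumes A: "A \<in> carrier_mat n n"
    and entries: "\<And>r c k. r < n \<Longrightarrow> c < n \<Longrightarrow> degree (coeff (A $$ (r, c)) k) \<le> k"
  shows "degree (coeff (det A) k) \<le> k"
proof -
  define S where "S = {p :: 'a poly poly. \<forall>k. degree (coeff p k) \<le> k}"
  have S_mult: "p * q \<in> S" if "p \<in> S" "q \<in> S" for p q
  proof -
    have "degree (coeff p i * coeff q (k - i)) \<le> k" if "i \<le> k" for i k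
    proof -
      have "degree (coeff p i * coeff q (k - i)) \<le> degree (coeff p i) + degree (coeff q (k - i))"
        by (rule degree_mult_le)
      also have "\<dots> \<le> i + (k - i)"
        using \<open>p \<in> S\<close> \<open>q \<in> S\<close> unfolding S_def by (intro add_mono) auto
      finally show ?thesis using that by simp
    qed
    then show ?thesis
      by (auto simp: S_def coeff_mult intro!: degree_sum_le)
  qed
  have S_1: "1 \<in> S"
    by (auto simp: S_def coeff_1)
  have S_sum: "(\<Sum>x\<in>B. f x) \<in> S" if "finite B" "\<And>x. x \<in> B \<Longrightarrow> f x \<in> S" for B :: "'x set" and f
    using that by (auto simp: S_def coeff_sum intro!: degree_sum_le)
  have S_prod: "(\<Prod>x\<in>B. f x) \<in> S" if "\<And>x. x \<in> B \<Longrightarrow> f x \<in> S" for B :: "'x set" and f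
    using that by (induction B rule: infinite_finite_induct) (auto intro: S_1 S_mult)
  have S_sign: "signof p \<in> S" for p :: "nat \<Rightarrow> nat"
    using S_1 by (auto simp: sign_def S_def)
  have dim: "dim_row A = n" "dim_col A = n"
    using A by auto
  have "A $$ (i, p i) \<in> S" if "p permutes {0..<n}" "i \<in> {0..<n}" for p i
    using entries[of i "p i"] permutes_in_image[OF that(1), of i] that(2) by (simp add: S_def)
  then have "det A \<in> S"
    unfolding det_def dim if_P[OF refl]
    by (intro S_sum S_mult S_sign S_prod finite_permutations) auto
  then show ?thesis by (simp add: S_def)
qed

subsection \<open>The matrix of a polynomial\<close>

text \<open>In 0-based indices the entry \<open>a\<^bsub>2\<beta>-\<alpha>\<^esub>\<close> is \<open>a\<^bsub>2c+1-r\<^esub>\<close>.\<close>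

definition coeff_mat :: "nat \<Rightarrow> complex poly \<Rightarrow> complex mat" where
  "coeff_mat m f = mat (m - 1) (m - 1)
     (\<lambda>(r, c). if r \<le> 2 * c + 1 then coeff f (2 * c + 1 - r) else 0)"

lemma coeff_mat_carrier [simp]: "coeff_mat m f \<in> carrier_mat (m - 1) (m - 1)"
  by (simp add: coeff_mat_def)

lemma coeff_mat_smult: "coeff_mat m (smult c f) = c \<cdot>\<^sub>m coeff_mat m f"
  by (rule eq_matI) (auto simp: coeff_mat_def)

text \<open>Above index \<open>m\<close>, \<open>indet\<close> is 0 by convention and the
  coefficient of \<open>f\<close> is 0 by the degree bound.\<close>

lemma map_eval_matM:
  assumes "degree f \<le> m"
  shows "map_mat (eval (coeff f)) (matM m) = coeff_mat m f"
proof (rule eq_matI)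
  fix r c assume "r < dim_row (coeff_mat m f)" "c < dim_col (coeff_mat m f)"
  then show "map_mat (eval (coeff f)) (matM m) $$ (r, c) = coeff_mat m f $$ (r, c)"
    using assms
    by (auto simp: matM_def coeff_mat_def Let_def eval_indet nat_diff_distrib' nat_mult_distrib
        intro!: coeff_eq_0 arg_cong[of _ _ "coeff f"])
qed (simp_all add: coeff_mat_def matM_def)

lemma eval_D:
  assumes "degree f \<le> m"
  shows "eval (coeff f) (D m j) = (-1) ^ (m - 1) * coeff (char_poly (coeff_mat m f)) j"
proof -
  have M: "matM m \<in> carrier_mat (m - 1) (m - 1)" by (simp add: matM_def)
  show ?thesis
    unfolding D_def det_minus_indeterminate[OF M]
    by (simp add: eval_mult eval.hom_power eval.hom_uminus
        map_eval_matM[OF assms, symmetric] eval.char_poly_hom[OF M])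
qed

definition H21_poly :: "nat \<Rightarrow> nat \<Rightarrow> cpoly poly" where
  "H21_poly m i =
     coeff (det (1\<^sub>m m - [:0, 1:] \<cdot>\<^sub>m map_mat (\<lambda>p. [:p:]) (matMt m))) (m - i)"

lemma coeff_H21_poly: "coeff (H21_poly m i) h = H21 m i h"
  by (simp add: H21_poly_def H21_def)

text \<open>Each entry is constant in t at T^0 and at most linear in t at T^1. The bound ensures
  that the range of \<open>h\<close> in the conjecture covers all coefficients of
  \<open>H21_poly\<close>.\<close>

lemma degree_H21_poly: "degree (H21_poly m i) \<le> m - i"
proof -
  have "degree (coeff ((1\<^sub>m m - [:0, 1:] \<cdot>\<^sub>m map_mat (\<lambda>p. [:p:]) (matMt m)) $$ (r, c)) k) \<le> k"
    if "r < m" "c < m" for r c k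
    using that by (auto simp: matMt_def Let_def coeff_pCons split: nat.split)
  then show ?thesis
    unfolding H21_poly_def by (intro degree_coeff_det_le[of _ m]) (auto simp: matMt_def)
qed

text \<open>The entry a_n t - a_(n-1) is the coefficient of x^n in f (t - x).\<close>

lemma eval_matMt:
  assumes "degree f \<le> m"
  shows "map_mat (\<lambda>q. poly (map_poly (eval (coeff f)) q) t) (matMt m)
    = coeff_mat (Suc m) (f * [:t, -1:])"
proof (rule eq_matI)
  fix r c assume rc: "r < dim_row (coeff_mat (Suc m) (f * [:t, -1:]))"
    "c < dim_col (coeff_mat (Suc m) (f * [:t, -1:]))"
  have ev: "eval (coeff f) (indet m (int n)) = coeff f n" for n
    using assms coeff_eq_0[of f n] by (auto simp: eval_indet)
  have neg: "indet m k = 0" if "k < 0" for k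
    using that by (simp add: indet_def)
  have co: "coeff (f * [:t, -1:]) n = coeff f n * t - (if n = 0 then 0 else coeff f (n - 1))" for n
    by (cases n) (simp_all add: mult.commute)
  have "map_mat (\<lambda>q. poly (map_poly (eval (coeff f)) q) t) (matMt m) $$ (r, c)
      = eval (coeff f) (indet m (2 * int c + 1 - int r)) * t
        - eval (coeff f) (indet m (2 * int c + 1 - int r - 1))"
    using rc by (simp add: matMt_def coeff_mat_def Let_def eval.hom_minus eval.hom_uminus
        algebra_simps
        eval.map_poly_pCons_hom)
  also have "\<dots> = coeff_mat (Suc m) (f * [:t, -1:]) $$ (r, c)"
  proof (cases "r \<le> 2 * c + 1")
    case True
    define n where "n = 2 * c + 1 - r"
    have n: "2 * int c + 1 - int r = int n"
      using True by (simp add: n_def of_nat_diff)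
    have entry: "coeff_mat (Suc m) (f * [:t, -1:]) $$ (r, c) = coeff (f * [:t, -1:]) n"
      using rc True by (simp add: coeff_mat_def n_def del: mult_pCons_right)
    show ?thesis
      unfolding n entry co
      \<comment> \<open>For \<open>n = 0\<close> the second index is -1: \<open>indet\<close> yields
        0 there, matching the missing lower coefficient in \<open>co\<close>.\<close>
      by (cases n) (use ev[of 0] in \<open>simp_all add: ev neg del: of_nat_Suc of_nat_add\<close>, simp add: ev)
  next
    case False
    then show ?thesis using rc by (simp add: coeff_mat_def neg)
  qed
  finally show "map_mat (\<lambda>q. poly (map_poly (eval (coeff f)) q) t) (matMt m) $$ (r, c)
      = coeff_mat (Suc m) (f * [:t, -1:]) $$ (r, c)" .
qed (simp_all add: coeff_mat_def matMt_def)

lemma eval_H21_poly: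
  assumes f: "degree f \<le> m" and j: "j \<le> m"
  shows "poly (map_poly (eval (coeff f)) (H21_poly m j)) t
    = coeff (char_poly (coeff_mat (Suc m) (f * [:t, -1:]))) j"
proof -
  define N where "N = coeff_mat (Suc m) (f * [:t, -1:])"
  have N: "N \<in> carrier_mat m m"
    using coeff_mat_carrier[of "Suc m"] by (simp add: N_def)
  interpret E: map_poly_comm_ring_hom "eval (coeff f)" ..
  \<comment> \<open>Substituting the coefficients of \<open>f\<close> for the variables and then a
    number for t is one ring homomorphism, so it commutes with the determinant.\<close>
  define h where "h = (\<lambda>q. poly (map_poly (eval (coeff f)) q) t)"
  interpret h: comm_ring_hom h
    by unfold_locales (simp_all add: h_def E.hom_add E.hom_mult)
  interpret H: map_poly_comm_ring_hom h ..
  have "h (H21_poly m j) = coeff (map_poly h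
      (det (1\<^sub>m m - [:0, 1:] \<cdot>\<^sub>m map_mat (\<lambda>p. [:p:]) (matMt m)))) (m - j)"
    by (simp add: H21_poly_def)
  also have "map_poly h (det (1\<^sub>m m - [:0, 1:] \<cdot>\<^sub>m map_mat (\<lambda>p. [:p:]) (matMt m)))
      = det (1\<^sub>m m - [:0, 1:] \<cdot>\<^sub>m map_mat (\<lambda>p. [:p:]) N)"
    unfolding comm_ring_hom.hom_det[OF H.comm_ring_hom_axioms, symmetric]
      N_def eval_matMt[OF f, symmetric] h_def[symmetric]
    by (rule arg_cong[of _ _ det], rule eq_matI)
      (auto simp: matMt_def H.hom_minus H.hom_uminus h.map_poly_pCons_hom)
  also have "\<dots> = reflect_poly (char_poly N)"
    by (rule det_one_minus_indeterminate_mult[OF N])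
  also have "coeff \<dots> (m - j) = coeff (char_poly N) j"
    using j degree_monic_char_poly[OF N] by (simp add: coeff_reflect_poly)
  finally show ?thesis by (simp add: h_def N_def)
qed

subsection \<open>Multiplication by linear factors\<close>

text \<open>For nonzero \<open>f\<close> of degree at most \<open>m\<close>, this says that its
  coefficient vector represents a point of \<open>X m i\<close>; \<open>m\<close> is only a nominal
  degree.\<close>

definition low_coeffs_vanish :: "nat \<Rightarrow> nat \<Rightarrow> complex poly \<Rightarrow> bool" where
  "low_coeffs_vanish m i f \<longleftrightarrow> (\<forall>j<i. coeff (char_poly (coeff_mat m f)) j = 0)"

lemma low_coeffs_vanish_iff_eval_D:
  "degree f \<le> m \<Longrightarrow> low_coeffs_vanish m i f \<longleftrightarrow> (\<forall>j<i. eval (coeff f) (D m j) = 0)"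
  by (simp add: low_coeffs_vanish_def eval_D)

lemma low_coeffs_vanish_smult:
  assumes "low_coeffs_vanish m i f" "c \<noteq> 0"
  shows "low_coeffs_vanish m i (smult c f)"
  using assms
  by (simp add: low_coeffs_vanish_def coeff_mat_smult coeff_char_poly_smult[OF coeff_mat_carrier])

text \<open>The case of a linear factor with root at infinity.\<close>

lemma char_poly_coeff_mat_Suc:
  assumes f: "degree f \<le> m" and m: "m \<ge> 1"
  shows "char_poly (coeff_mat (Suc m) f) = [:- coeff f m, 1:] * char_poly (coeff_mat m f)"
proof -
  obtain n where n: "m = Suc n" using m by (cases m) auto
  define A where "A = char_poly_matrix (coeff_mat (Suc m) f)"
  have A: "A \<in> carrier_mat m m"
    using coeff_mat_carrier[of "Suc m" f] by (simp add: A_def)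
  \<comment> \<open>The index 2n+1-r equals \<open>m\<close> for \<open>r = n\<close> and exceeds it
    for \<open>r < n\<close>, so only the diagonal entry of the last column survives in the
    expansion.\<close>
  have col: "A $$ (r, n) = 0" if "r < n" for r
    using that f n by (auto simp: A_def char_poly_matrix_def coeff_mat_def intro!: coeff_eq_0)
  have "det A = (\<Sum>r<m. A $$ (r, n) * cofactor A r n)"
    by (rule laplace_expansion_column[OF A]) (simp add: n)
  also have "\<dots> = A $$ (n, n) * cofactor A n n"
    using col by (simp add: n)
  also have "A $$ (n, n) = [:- coeff f m, 1:]"
    by (simp add: A_def char_poly_matrix_def coeff_mat_def n)
  also have "mat_delete A n n = char_poly_matrix (coeff_mat m f)"
    by (rule eq_matI) (auto simp: A_def char_poly_matrix_def coeff_mat_def mat_delete_def n)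
  then have "cofactor A n n = char_poly (coeff_mat m f)"
    by (simp add: cofactor_def char_poly_def)
  finally show ?thesis
    by (simp only: char_poly_def A_def)
qed

text \<open>A coefficient of the product with a linear factor involves only coefficients of the same
  and the next lower index, so zeros below \<open>i\<close> persist.\<close>

lemma low_coeffs_vanish_Suc:
  assumes "low_coeffs_vanish m i f" "degree f \<le> m" "m \<ge> 1"
  shows "low_coeffs_vanish (Suc m) i f"
  using assms(1)
  by (auto simp: low_coeffs_vanish_def char_poly_coeff_mat_Suc[OF assms(2,3)] coeff_pCons
      split: nat.split)

text \<open>For \<open>j < i\<close> all generators \<open>D m k\<close> with
  \<open>k \<le> j\<close> vanish at \<open>f\<close>, hence so does every \<open>H21 m j h\<close>.
  The resulting zero polynomial in t has the wanted coefficient as its value.\<close>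

lemma low_coeffs_vanish_linear_factor:
  assumes hyp: "\<And>j h. j < i \<Longrightarrow> h \<le> m - j \<Longrightarrow>
      \<exists>\<kappa>. H21 m j h ^ \<kappa> \<in> Idl\<^bsub>poly_ring m\<^esub> {D m k | k. k \<le> j}"
    and van: "low_coeffs_vanish m i f" and f: "degree f \<le> m" and i: "i \<le> m"
  shows "low_coeffs_vanish (Suc m) i (f * [:-t, 1:])"
proof -
  have "coeff (char_poly (coeff_mat (Suc m) (f * [:t, -1:]))) j = 0" if j: "j < i" for j
  proof -
    have "eval (coeff f) (H21 m j h) = 0" for h
    proof (cases "h \<le> m - j")
      case True
      then obtain \<kappa> where \<kappa>: "H21 m j h ^ \<kappa> \<in> Idl\<^bsub>poly_ring m\<^esub> {D m k | k. k \<le> j}"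
        using hyp j by blast
      have "eval (coeff f) s = 0" if "s \<in> {D m k | k. k \<le> j}" for s
        using that van j f by (auto simp: low_coeffs_vanish_iff_eval_D)
      moreover have "{D m k | k. k \<le> j} \<subseteq> carrier (poly_ring m)"
        using D_in_poly_ring by blast
      ultimately show ?thesis
        using eval_eq_0_if_power_in_ideal[OF _ _ \<kappa>] by blast
    next
      case False
      then have "H21 m j h = 0"
        using degree_H21_poly[of m j] unfolding coeff_H21_poly[symmetric]
        by (intro coeff_eq_0) linarith
      then show ?thesis by simp
    qed
    then have "map_poly (eval (coeff f)) (H21_poly m j) = 0"
      by (intro poly_eqI) (simp add: coeff_map_poly coeff_H21_poly)
    then show ?thesis
      using eval_H21_poly[OF f, of j t] i j by simp
  qed
  then have "low_coeffs_vanish (Suc m) i (f * [:t, -1:])"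
    by (simp add: low_coeffs_vanish_def)
  \<comment> \<open>The factor x - t differs from t - x by the nonzero scalar -1.\<close>
  then have "low_coeffs_vanish (Suc m) i (smult (-1) (f * [:t, -1:]))"
    by (rule low_coeffs_vanish_smult) simp
  then show ?thesis
    by simp
qed

text \<open>Induction on \<open>\<theta>\<close> removes one linear factor of \<open>b\<close> at a
  time, with its root at infinity or in the complex numbers.\<close>

lemma low_coeffs_vanish_mult:
  assumes hyp: "\<And>m j h. m \<ge> 2 \<Longrightarrow> j \<le> m - 1 \<Longrightarrow> h \<le> m - j \<Longrightarrow>
      \<exists>\<kappa>. H21 m j h ^ \<kappa> \<in> Idl\<^bsub>poly_ring m\<^esub> {D m k | k. k \<le> j}"
    and van: "low_coeffs_vanish m i f" and f: "degree f \<le> m" and i: "1 \<le> i" "i < m"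
    and b: "degree b \<le> \<theta>" "b \<noteq> 0"
  shows "low_coeffs_vanish (m + \<theta>) i (f * b)"
  using b
proof (induction \<theta> arbitrary: b)
  case 0
  then obtain c where "b = [:c:]" "c \<noteq> 0"
    by (metis bot_nat_0.extremum_uniqueI degree_eq_zeroE pCons_0_0)
  then show ?case
    using low_coeffs_vanish_smult[OF van] by simp
next
  case (Suc \<theta>)
  have deg: "degree (f * b') \<le> m + \<theta>" if "degree b' \<le> \<theta>" for b'
    using degree_mult_le[of f b'] f that by linarith
  show ?case
  proof (cases "degree b \<le> \<theta>")
    \<comment> \<open>Root at infinity: \<open>b\<close> is unchanged and only the nominal degree
      grows.\<close>
    case True
    then show ?thesis
      using low_coeffs_vanish_Suc[OF Suc.IH[of b] deg[of b]] Suc.prems i by simp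
  next
    case False
    then have "\<not> constant (poly b)"
      by (simp add: constant_degree)
    then obtain t where "poly b t = 0"
      using fundamental_theorem_of_algebra by blast
    then obtain b' where b': "b = [:-t, 1:] * b'"
      by (auto simp: poly_eq_0_iff_dvd)
    with Suc.prems have nz: "b' \<noteq> 0" by auto
    then have deg': "degree b' \<le> \<theta>"
      using Suc.prems(1) unfolding b' by (subst (asm) degree_mult_eq) simp_all
    have "low_coeffs_vanish (Suc (m + \<theta>)) i (f * b' * [:-t, 1:])"
    proof (rule low_coeffs_vanish_linear_factor)
      show "\<exists>\<kappa>. H21 (m + \<theta>) j h ^ \<kappa> \<in> Idl\<^bsub>poly_ring (m + \<theta>)\<^esub> {D (m + \<theta>) k | k. k \<le> j}"
        if "j < i" "h \<le> m + \<theta> - j" for j h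
        using that i by (intro hyp) auto
    qed (use Suc.IH[OF deg' nz] deg[OF deg'] i in auto)
    then show ?thesis by (simp add: b' mult_ac del: mult_pCons_right mult_pCons_left)
  qed
qed

section \<open>From polynomials back to points of projective space\<close>

lemma coeff_coord_poly_hcoords: "a \<in> hcoords m \<Longrightarrow> coeff (coord_poly m a) = a"
  by (auto simp: coeff_coord_poly hcoords_def fun_eq_iff)

lemma degree_coord_poly: "degree (coord_poly m a) \<le> m"
  by (auto intro!: degree_le simp: coeff_coord_poly)

theorem proposition7p1:
  assumes "\<forall>m i h :: nat. m \<ge> 2 \<and> i \<le> m - 1 \<and> h \<le> m - i \<longrightarrow>
    (\<exists>\<kappa>\<ge>1. H21 m i h ^ \<kappa> \<in> Idl\<^bsub>poly_ring m\<^esub> {D m j | j. j \<le> i})"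
  shows "\<forall>m i \<theta> :: nat. m > i \<and> i \<ge> 1 \<and> \<theta> \<ge> 1 \<longrightarrow>
    \<nu> m \<theta> ` (X m i \<times> proj_space \<theta>) \<subseteq> X (m + \<theta>) i"
proof (intro allI impI subsetI)
  fix m i \<theta> :: nat and R
  assume mi: "m > i \<and> i \<ge> 1 \<and> \<theta> \<ge> 1" and "R \<in> \<nu> m \<theta> ` (X m i \<times> proj_space \<theta>)"
  then obtain P Q where P: "P \<in> X m i" and Q: "Q \<in> proj_space \<theta>" and R: "R = \<nu> m \<theta> (P, Q)"
    by auto
  from P have PX: "P \<in> proj_space m" "\<And>a j. a \<in> P \<Longrightarrow> j < i \<Longrightarrow> eval a (D m j) = 0"
    by (auto simp: X_def)
  obtain l where l: "l \<in> hcoords m" "P = proj_rel m `` {l}"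
    using PX(1) unfolding proj_space_def by (auto elim: quotientE)
  obtain b where b: "b \<in> hcoords \<theta>" "Q = proj_rel \<theta> `` {b}"
    using Q unfolding proj_space_def by (auto elim: quotientE)
  have lP: "l \<in> P"
    unfolding l(2) by (rule equiv_class_self[OF equiv_proj_rel l(1)])
  have van_l: "low_coeffs_vanish m i (coord_poly m l)"
    using PX(2)[OF lP]
    by (simp add: low_coeffs_vanish_iff_eval_D degree_coord_poly coeff_coord_poly_hcoords[OF l(1)])
  have nz: "coord_poly \<theta> b \<noteq> 0"
    using b(1) coeff_coord_poly_hcoords[OF b(1)] by (auto simp: hcoords_def)
  have van: "low_coeffs_vanish (m + \<theta>) i (coord_poly m l * coord_poly \<theta> b)"
  proof (rule low_coeffs_vanish_mult[OF _ van_l degree_coord_poly _ _ degree_coord_poly nz])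
    show "\<exists>\<kappa>. H21 n j h ^ \<kappa> \<in> Idl\<^bsub>poly_ring n\<^esub> {D n k | k. k \<le> j}"
      if "n \<ge> 2" "j \<le> n - 1" "h \<le> n - j" for n j h
      using assms that by blast
  qed (use mi in simp_all)
  \<comment> \<open>Membership in \<open>X\<close> concerns every representative; each is a nonzero
    multiple of the product already treated.\<close>
  have "eval a (D (m + \<theta>) j) = 0" if a: "a \<in> R" and j: "j < i" for a j
  proof -
    obtain c where c: "c \<noteq> 0" "\<forall>k. a k = c * coeff (coord_poly m l * coord_poly \<theta> b) k"
      using a unfolding R l(2) b(2) \<nu>_class[OF l(1) b(1)] by (auto simp: proj_rel_def)
    define g where "g = smult c (coord_poly m l * coord_poly \<theta> b)"
    have "a = coeff g"
      using c by (auto simp: g_def)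
    moreover have "degree g \<le> m + \<theta>"
      using degree_mult_le[of "coord_poly m l" "coord_poly \<theta> b"] degree_coord_poly[of m l]
        degree_coord_poly[of \<theta> b] degree_smult_le[of c "coord_poly m l * coord_poly \<theta> b"]
      unfolding g_def by linarith
    moreover have "low_coeffs_vanish (m + \<theta>) i g"
      unfolding g_def by (rule low_coeffs_vanish_smult[OF van c(1)])
    ultimately show ?thesis
      using j by (simp add: low_coeffs_vanish_iff_eval_D)
  qed
  moreover have "R \<in> proj_space (m + \<theta>)"
    using \<nu>_maps_to PX(1) Q unfolding R by blast
  ultimately show "R \<in> X (m + \<theta>) i"
    by (auto simp: X_def)
qed

end
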